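(* Let $\mathbf C$ be a highly selective category, and let $[f_1,\ldots,f_n]$ be a morphism in $\mathrm{WW}(\mathbf C)$, where $X_{j-1}\stackrel{f_j}{\longleftarrow}X_j$ for $j=1,\dots,n$. Then there exist an object $Q$ and morphisms $A\in\mathrm{Hom}(X_0,Q)$ and $B\in\mathrm{Hom}(Q,X_n)$ in $\mathbf C$ such that $A$ is a reduction, $B$ is a coreduction, and $[f_1,\ldots,f_n]=[A,B]$ in $\mathrm{WW}(\mathbf C)$.
   Context: Morphisms are written from right to left: $\mathrm{Hom}(X,Y)$ denotes the morphisms $X\leftarrow Y$ to $X$ from $Y$, and $(f,g)$ is composable, with composition $fg$, when $X\stackrel{f}{\leftarrow}Y\stackrel{g}{\leftarrow}Z$. A selective category is a category together with a distinguished class of morphisms, called suave, and a class of composable pairs of suave morphisms, called congenial pairs, such that: (1) every identity morphism is suave; (2) if $f$ and $g$ are suave, $(f,g)$ is composable, and $f$ or $g$ is an identity morphism, then $(f,g)$ is congenial; (3) if $(f,g)$ is congenial, then $fg$ is suave; (4) if $f$ is a suave isomorphism, then $f^{-1}$ is suave, and $(f,f^{-1})$ and $(f^{-1},f)$ are both congenial; (5) if $(f,g,h)$ is a composable triple, then $(f,g)$ and $(fg,h)$ are congenial if and only if $(g,h)$ and $(f,gh)$ are. A highly selective category is a selective category provided with two subcategories of suave morphisms, called reductions and coreductions, such that: (1) any suave isomorphism is both a coreduction and a reduction; (2) if $(f,g)$ is a composable pair of suave morphisms, and $f$ is a coreduction or $g$ is a reduction, then $(f,g)$ is congenial; (3)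 any suave morphism $f$ may be factored as $gh$, where $g$ is a reduction, $h$ is a coreduction, and $(g,h)$ is congenial. Wehrheim–Woodward category. A path in $\mathbf C$ is a composable sequence $(\ldots,f_{-1},f_0,f_1,\ldots)$ of morphisms indexed by the integers, only finitely many of which are not identity morphisms; its target (source) is the object whose identity appears for all large negative (positive) indices. Two paths are equivalent if one is obtained from the other by inserting and removing finitely many identity morphisms. Equivalence classes of paths of suave morphisms are the morphisms of a category $P_s(\mathbf C)$ with the objects of $\mathbf C$, composition being concatenation (after truncating the identities at the ends being joined). $\mathrm{WW}(\mathbf C)$ is the quotient category of $P_s(\mathbf C)$ by the smallest equivalence relation for which two paths are equivalent whenever a sequence representing one is obtained from a sequence representing the other by replacing successive entries forming a congenial pair $(p,q)$ by the composition $pq$ preceded or followed by an identity morphism. The morphism of $\mathrm{WW}(\mathbf C)$ represented by a finite composable sequence of suave morphisms $f_1,\dots,f_n$ (extended by identities) is denoted $[f_1,\ldots,f_n]$. *)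

theory Defs
  imports Main
begin

text \<open>Morphisms are written from right to left: \<open>Hom C X Y\<close> consists of the morphisms to \<open>X\<close>
  from \<open>Y\<close>, and \<open>f \<cdot> g\<close> makes sense when the source of \<open>f\<close> is the target of \<open>g\<close>.\<close>

record ('o, 'm) category =
  Obj :: "'o set"
  Mor :: "'m set"
  tgt :: "'m \<Rightarrow> 'o"
  src :: "'m \<Rightarrow> 'o"
  ident :: "'o \<Rightarrow> 'm"
  compose :: "'m \<Rightarrow> 'm \<Rightarrow> 'm"  (infixl \<open>\<cdot>\<index>\<close> 70)

definition Hom :: "('o, 'm, 'z) category_scheme \<Rightarrow> 'o \<Rightarrow> 'o \<Rightarrow> 'm set" where
  "Hom C X Y = {f \<in> Mor C. tgt C f = X \<and> src C f = Y}"

definition composable :: "('o, 'm, 'z) category_scheme \<Rightarrow> 'm \<Rightarrow> 'm \<Rightarrow> bool" where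
  "composable C f g \<longleftrightarrow> f \<in> Mor C \<and> g \<in> Mor C \<and> src C f = tgt C g"

definition identities :: "('o, 'm, 'z) category_scheme \<Rightarrow> 'm set" where
  "identities C = ident C ` Obj C"

definition mutually_inverse :: "('o, 'm, 'z) category_scheme \<Rightarrow> 'm \<Rightarrow> 'm \<Rightarrow> bool" where
  "mutually_inverse C f g \<longleftrightarrow> composable C f g \<and> composable C g f \<and>
     f \<cdot>\<^bsub>C\<^esub> g = ident C (tgt C f) \<and> g \<cdot>\<^bsub>C\<^esub> f = ident C (src C f)"

definition isomorphism :: "('o, 'm, 'z) category_scheme \<Rightarrow> 'm \<Rightarrow> bool" where
  "isomorphism C f \<longleftrightarrow> (\<exists>g. mutually_inverse C f g)"

text \<open>A subcategory is given by its set of morphisms; its objects are those whose identity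
  morphisms it contains.\<close>

definition subcategory :: "('o, 'm, 'z) category_scheme \<Rightarrow> 'm set \<Rightarrow> bool" where
  "subcategory C S \<longleftrightarrow> S \<subseteq> Mor C \<and>
     (\<forall>f\<in>S. ident C (tgt C f) \<in> S \<and> ident C (src C f) \<in> S) \<and>
     (\<forall>f\<in>S. \<forall>g\<in>S. composable C f g \<longrightarrow> f \<cdot>\<^bsub>C\<^esub> g \<in> S)"

locale category =
  fixes C (structure)
  assumes tgt_Obj: "f \<in> Mor C \<Longrightarrow> tgt C f \<in> Obj C"
    and src_Obj: "f \<in> Mor C \<Longrightarrow> src C f \<in> Obj C"
    and ident_Hom: "X \<in> Obj C \<Longrightarrow> ident C X \<in> Hom C X X"
    and compose_Hom: "composable C f g \<Longrightarrow> f \<cdot> g \<in> Hom C (tgt C f) (src C g)"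
    and ident_compose: "f \<in> Mor C \<Longrightarrow> ident C (tgt C f) \<cdot> f = f"
    and compose_ident: "f \<in> Mor C \<Longrightarrow> f \<cdot> ident C (src C f) = f"
    and compose_assoc: "\<lbrakk>composable C f g; composable C g h\<rbrakk> \<Longrightarrow> (f \<cdot> g) \<cdot> h = f \<cdot> (g \<cdot> h)"

record ('o, 'm) selective_category = "('o, 'm) category" +
  suave :: "'m set"
  congenial :: "('m \<times> 'm) set"

locale selective_category = category +
  assumes suave_Mor: "suave C \<subseteq> Mor C"
    and congenial_suave:
      "(f, g) \<in> congenial C \<Longrightarrow> f \<in> suave C \<and> g \<in> suave C \<and> composable C f g"
    and ident_suave: "X \<in> Obj C \<Longrightarrow> ident C X \<in> suave C"
    and ident_congenial:
      "\<lbrakk>f \<in> suave C; g \<in> suave C; composable C f g; f \<in> identities C \<or> g \<in> identities C\<rbrakk>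
        \<Longrightarrow> (f, g) \<in> congenial C"
    and compose_suave: "(f, g) \<in> congenial C \<Longrightarrow> f \<cdot> g \<in> suave C"
    and inverse_suave:
      "\<lbrakk>f \<in> suave C; mutually_inverse C f g\<rbrakk>
        \<Longrightarrow> g \<in> suave C \<and> (f, g) \<in> congenial C \<and> (g, f) \<in> congenial C"
    and congenial_assoc:
      "\<lbrakk>composable C f g; composable C g h\<rbrakk>
        \<Longrightarrow> (f, g) \<in> congenial C \<and> (f \<cdot> g, h) \<in> congenial C \<longleftrightarrow>
            (g, h) \<in> congenial C \<and> (f, g \<cdot> h) \<in> congenial C"

record ('o, 'm) highly_selective_category = "('o, 'm) selective_category" +
  reductions :: "'m set"
  coreductions :: "'m set"

locale highly_selective_category = selective_category +
  assumes reductions_suave: "reductions C \<subseteq> suave C"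
    and reductions_subcategory: "subcategory C (reductions C)"
    and coreductions_suave: "coreductions C \<subseteq> suave C"
    and coreductions_subcategory: "subcategory C (coreductions C)"
    and suave_isomorphism:
      "\<lbrakk>f \<in> suave C; isomorphism C f\<rbrakk> \<Longrightarrow> f \<in> coreductions C \<and> f \<in> reductions C"
    and reduction_congenial:
      "\<lbrakk>f \<in> suave C; g \<in> suave C; composable C f g; f \<in> coreductions C \<or> g \<in> reductions C\<rbrakk>
        \<Longrightarrow> (f, g) \<in> congenial C"
    and suave_factor:
      "f \<in> suave C \<Longrightarrow>
        \<exists>g\<in>reductions C. \<exists>h\<in>coreductions C. (g, h) \<in> congenial C \<and> f = g \<cdot> h"

text \<open>The smallest equivalence relation on \<open>A\<close> containing \<open>r\<close>, for \<open>r \<subseteq> A \<times> A\<close>.\<close>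

definition generated_equiv :: "'a set \<Rightarrow> ('a \<times> 'a) set \<Rightarrow> ('a \<times> 'a) set" where
  "generated_equiv A r = \<Inter>{E. equiv A E \<and> r \<subseteq> E}"

definition paths :: "('o, 'm, 'z) category_scheme \<Rightarrow> (int \<Rightarrow> 'm) set" where
  "paths C = {p. (\<forall>i. composable C (p i) (p (i + 1))) \<and> finite {i. p i \<notin> identities C}}"

definition path_target :: "('o, 'm, 'z) category_scheme \<Rightarrow> (int \<Rightarrow> 'm) \<Rightarrow> 'o" where
  "path_target C p = (THE X. X \<in> Obj C \<and> (\<exists>N. \<forall>i\<le>N. p i = ident C X))"

definition path_source :: "('o, 'm, 'z) category_scheme \<Rightarrow> (int \<Rightarrow> 'm) \<Rightarrow> 'o" where
  "path_source C p = (THE X. X \<in> Obj C \<and> (\<exists>N. \<forall>i\<ge>N. p i = ident C X))"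

text \<open>Entries from position \<open>k\<close> on are moved to the right. Inserting in the left-hand tail of
  identities thus amounts to a translation, so the equivalence relation below
  identifies paths differing by a translation, and it does not matter to which side the
  entries are moved.\<close>

definition insert_identity ::
  "('o, 'm, 'z) category_scheme \<Rightarrow> int \<Rightarrow> 'o \<Rightarrow> (int \<Rightarrow> 'm) \<Rightarrow> int \<Rightarrow> 'm" where
  "insert_identity C k X p =
     (\<lambda>i. if i < k then p i else if i = k then ident C X else p (i - 1))"

definition path_equiv :: "('o, 'm, 'z) category_scheme \<Rightarrow> ((int \<Rightarrow> 'm) \<times> (int \<Rightarrow> 'm)) set" where
  "path_equiv C = generated_equiv (paths C)
     {(p, q). p \<in> paths C \<and> q \<in> paths C \<and> (\<exists>k. \<exists>X\<in>Obj C. q = insert_identity C k X p)}"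

text \<open>All concatenations of \<open>p\<close> and \<open>q\<close>, for all ways to truncate the right-hand
  identities of \<open>p\<close> (at \<open>a\<close>) and the left-hand identities of \<open>q\<close> (at \<open>b\<close>).\<close>

definition concatenations ::
  "('o, 'm, 'z) category_scheme \<Rightarrow> (int \<Rightarrow> 'm) \<Rightarrow> (int \<Rightarrow> 'm) \<Rightarrow> (int \<Rightarrow> 'm) set" where
  "concatenations C p q =
     {\<lambda>i. if i < 0 then p (i + a) else q (i + b) | a b.
        (\<forall>i\<ge>a. p i \<in> identities C) \<and> (\<forall>i<b. q i \<in> identities C)}"

definition suave_paths :: "('o, 'm, 'z) selective_category_scheme \<Rightarrow> (int \<Rightarrow> 'm) set" where
  "suave_paths C = {p \<in> paths C. \<forall>i. p i \<in> suave C}"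

text \<open>In \<open>Ps C\<close> and \<open>WW C\<close>, operations on equivalence classes are given by
  representatives; the unions and images are over sets on which the result is constant.\<close>

definition Ps ::
  "('o, 'm, 'z) selective_category_scheme \<Rightarrow> ('o, (int \<Rightarrow> 'm) set) category" where
  "Ps C = \<lparr>
     Obj = Obj C,
     Mor = suave_paths C // path_equiv C,
     tgt = (\<lambda>P. the_elem (path_target C ` P)),
     src = (\<lambda>P. the_elem (path_source C ` P)),
     ident = (\<lambda>X. path_equiv C `` {\<lambda>i. ident C X}),
     compose = (\<lambda>P Q. \<Union>p\<in>P. \<Union>q\<in>Q. \<Union>r\<in>concatenations C p q. path_equiv C `` {r})\<rparr>"

definition contraction ::
  "('o, 'm, 'z) selective_category_scheme \<Rightarrow> (int \<Rightarrow> 'm) \<Rightarrow> (int \<Rightarrow> 'm) \<Rightarrow> bool" where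
  "contraction C p q \<longleftrightarrow> (\<exists>k. (p k, p (k + 1)) \<in> congenial C \<and>
     (q = p(k := p k \<cdot>\<^bsub>C\<^esub> p (k + 1), k + 1 := ident C (src C (p (k + 1)))) \<or>
      q = p(k := ident C (tgt C (p k)), k + 1 := p k \<cdot>\<^bsub>C\<^esub> p (k + 1))))"

definition WW_equiv ::
  "('o, 'm, 'z) selective_category_scheme \<Rightarrow> ((int \<Rightarrow> 'm) set \<times> (int \<Rightarrow> 'm) set) set" where
  "WW_equiv C = generated_equiv (Mor (Ps C))
     {(P, Q). P \<in> Mor (Ps C) \<and> Q \<in> Mor (Ps C) \<and> (\<exists>p\<in>P. \<exists>q\<in>Q. contraction C p q)}"

definition WW ::
  "('o, 'm, 'z) selective_category_scheme \<Rightarrow> ('o, (int \<Rightarrow> 'm) set set) category" where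
  "WW C = \<lparr>
     Obj = Obj (Ps C),
     Mor = Mor (Ps C) // WW_equiv C,
     tgt = (\<lambda>F. the_elem (tgt (Ps C) ` F)),
     src = (\<lambda>F. the_elem (src (Ps C) ` F)),
     ident = (\<lambda>X. WW_equiv C `` {ident (Ps C) X}),
     compose = (\<lambda>F G. \<Union>P\<in>F. \<Union>Q\<in>G. WW_equiv C `` {P \<cdot>\<^bsub>Ps C\<^esub> Q})\<rparr>"

text \<open>The extension by identities of a nonempty composable list of morphisms.\<close>

definition list_path :: "('o, 'm, 'z) category_scheme \<Rightarrow> 'm list \<Rightarrow> int \<Rightarrow> 'm" where
  "list_path C fs = (\<lambda>i.
     if i < 0 then ident C (tgt C (hd fs))
     else if i < int (length fs) then fs ! nat i
     else ident C (src C (last fs)))"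

text \<open>The morphism \<open>[f\<^sub>1, \<dots>, f\<^sub>n]\<close> of \<open>WW C\<close>.\<close>

definition WW_class ::
  "('o, 'm, 'z) selective_category_scheme \<Rightarrow> 'm list \<Rightarrow> (int \<Rightarrow> 'm) set set" where
  "WW_class C fs = WW_equiv C `` {path_equiv C `` {list_path C fs}}"

end

theory Submission imports Defs begin

text \<open>
  A composable pair of suave morphisms is congenial as soon as its left entry is a coreduction or
  its right entry is a reduction. A word that starts with a reduction \<open>A\<close> and a coreduction
  \<open>B\<close> can therefore absorb its next entry \<open>f\<close>. The pair \<open>(B, f)\<close> is congenial, so \<open>B \<cdot> f\<close> is suave and factors as
  \<open>g \<cdot> h\<close> with \<open>g\<close> a reduction and \<open>h\<close> a coreduction; and \<open>(A, g)\<close> is congenial, so that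
  \<open>[A, B, f, \<dots>] = [A, B \<cdot> f, \<dots>] = [A, g, h, \<dots>] = [A \<cdot> g, h, \<dots>]\<close>,
  where \<open>A \<cdot> g\<close> is a reduction because reductions form a subcategory. Factoring
  \<open>f\<^sub>1\<close> brings a word into the initial form, and absorbing the remaining entries one at a time
  leaves just two (\<open>absorb_into_reduction_coreduction\<close>).

  Every equality in this argument replaces two neighbouring entries \<open>p, q\<close> of a word, congenial to
  each other, by \<open>p \<cdot> q\<close>, or does the converse, so all that has to be known about the
  Wehrheim-Woodward category is that this does not change the class (\<open>WW_class_contract\<close>).
\<close>

section \<open>Generated equivalence relations\<close>

lemma equiv_generated_equiv:
  assumes "r \<subseteq> A \<times> A"
  shows "equiv A (generated_equiv A r)"
proof -
  have total: "equiv A (A \<times> A)"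
    by (auto simp: equiv_def refl_on_def sym_def trans_def)
  show ?thesis
  proof (rule equivI)
    \<comment> \<open>The total relation belongs to the family, so the intersection stays within \<open>A\<close>.\<close>
    show "generated_equiv A r \<subseteq> A \<times> A"
      using total assms by (auto simp: generated_equiv_def)
    show "refl_on A (generated_equiv A r)"
      by (auto simp: generated_equiv_def refl_on_def equiv_def)
    show "sym (generated_equiv A r)"
      by (auto simp: generated_equiv_def equiv_def intro!: symI dest: symD)
    show "trans (generated_equiv A r)"
    proof (rule transI)
      fix x y z
      assume "(x, y) \<in> generated_equiv A r" "(y, z) \<in> generated_equiv A r"
      then show "(x, z) \<in> generated_equiv A r"
        unfolding generated_equiv_def equiv_def by (blast dest: transD)
    qed
  qed
qed

lemma generated_equiv_base: "x \<in> r \<Longrightarrow> x \<in> generated_equiv A r"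
  by (auto simp: generated_equiv_def)

lemma equiv_path_equiv: "equiv (paths C) (path_equiv C)"
  unfolding path_equiv_def by (rule equiv_generated_equiv) auto

lemma equiv_WW_equiv: "equiv (Mor (Ps C)) (WW_equiv C)"
  unfolding WW_equiv_def by (rule equiv_generated_equiv) auto

section \<open>Words of suave morphisms\<close>

definition suave_word :: "('o, 'm, 'z) selective_category_scheme \<Rightarrow> 'm list \<Rightarrow> bool" where
  "suave_word C fs \<longleftrightarrow> fs \<noteq> [] \<and> set fs \<subseteq> suave C \<and> successively (composable C) fs"

context selective_category
begin

lemma composable_ident_left: "f \<in> Mor C \<Longrightarrow> composable C (ident C (tgt C f)) f"
  using ident_Hom[OF tgt_Obj, of f] by (auto simp: composable_def Hom_def)

lemma composable_ident_right: "f \<in> Mor C \<Longrightarrow> composable C f (ident C (src C f))"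
  using ident_Hom[OF src_Obj, of f] by (auto simp: composable_def Hom_def)

lemma composable_ident_ident: "X \<in> Obj C \<Longrightarrow> composable C (ident C X) (ident C X)"
  using ident_Hom[of X] by (auto simp: composable_def Hom_def)

lemma list_path_suave_paths:
  assumes "suave_word C fs"
  shows "list_path C fs \<in> suave_paths C"
proof -
  let ?p = "list_path C fs" and ?n = "int (length fs)"
  have ne: "fs \<noteq> []" and suave: "set fs \<subseteq> suave C" and succ: "successively (composable C) fs"
    using assms by (auto simp: suave_word_def)
  have mor: "hd fs \<in> Mor C" "last fs \<in> Mor C"
    using suave suave_Mor hd_in_set[OF ne] last_in_set[OF ne] by (simp_all add: subset_iff)
  have "composable C (?p i) (?p (i + 1))" for i
  proof -
    consider "i + 1 < 0" | "i = -1" | "0 \<le> i" "i + 1 < ?n" | "i = ?n - 1" | "i \<ge> ?n"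
      by linarith
    then show ?thesis
    proof cases
      case 1
      then show ?thesis
        using composable_ident_ident[OF tgt_Obj[OF mor(1)]] by (simp add: list_path_def)
    next
      case 2
      then show ?thesis
        using composable_ident_left[OF mor(1)] ne by (simp add: list_path_def hd_conv_nth)
    next
      case 3
      then have "nat (i + 1) = Suc (nat i)" "Suc (nat i) < length fs"
        by auto
      then show ?thesis
        using 3 succ by (simp add: list_path_def successively_conv_nth)
    next
      case 4
      then have "nat i = length fs - 1" "i \<ge> 0"
        using ne by (auto simp: Suc_le_eq)
      then show ?thesis
        using 4 composable_ident_right[OF mor(2)] ne by (simp add: list_path_def last_conv_nth)
    next
      case 5
      then show ?thesis
        using composable_ident_ident[OF src_Obj[OF mor(2)]] by (simp add: list_path_def)
    qed
  qed
  moreover have "finite {i. ?p i \<notin> identities C}"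
  proof (rule finite_subset)
    show "{i. ?p i \<notin> identities C} \<subseteq> {0..<?n}"
      using tgt_Obj[OF mor(1)] src_Obj[OF mor(2)]
      by (auto simp: list_path_def identities_def)
  qed simp
  moreover have "?p i \<in> suave C" for i
    using suave ident_suave[OF tgt_Obj[OF mor(1)]] ident_suave[OF src_Obj[OF mor(2)]]
    by (auto simp: list_path_def subset_iff)
  ultimately show ?thesis
    by (auto simp: suave_paths_def paths_def)
qed

lemma path_class_Mor_Ps:
  "suave_word C fs \<Longrightarrow> path_equiv C `` {list_path C fs} \<in> Mor (Ps C)"
  by (simp add: Ps_def quotientI list_path_suave_paths)

lemma suave_word_contract:
  assumes "suave_word C (us @ p # q # vs)" "(p, q) \<in> congenial C"
  shows "suave_word C (us @ p \<cdot> q # vs)"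
proof -
  have pq: "composable C p q" "p \<cdot> q \<in> suave C"
    using assms(2) congenial_suave compose_suave by auto
  then have "p \<cdot> q \<in> Mor C" "tgt C (p \<cdot> q) = tgt C p" "src C (p \<cdot> q) = src C q"
    using compose_Hom[of p q] by (auto simp: Hom_def)
  then show ?thesis
    using assms(1) pq
    by (auto simp: suave_word_def successively_append_iff successively_Cons composable_def)
qed

lemma suave_word_expand:
  assumes "suave_word C (us @ p \<cdot> q # vs)" "(p, q) \<in> congenial C"
  shows "suave_word C (us @ p # q # vs)"
proof -
  have pq: "composable C p q" "p \<in> suave C" "q \<in> suave C"
    using assms(2) congenial_suave by auto
  then have "tgt C (p \<cdot> q) = tgt C p" "src C (p \<cdot> q) = src C q"
    using compose_Hom[of p q] by (auto simp: Hom_def)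
  then show ?thesis
    using assms(1) pq
    by (auto simp: suave_word_def successively_append_iff successively_Cons composable_def)
qed

section \<open>Contracting a word\<close>

lemma list_path_insert_identity:
  assumes "f \<in> Mor C"
  shows "list_path C (us @ f # ident C (src C f) # vs) =
     insert_identity C (int (length us) + 1) (src C f) (list_path C (us @ f # vs))"
proof
  fix i :: int
  have f: "src C (ident C (src C f)) = src C f"
    using ident_Hom[OF src_Obj[OF assms]] by (simp add: Hom_def)
  have hd: "hd (us @ f # ident C (src C f) # vs) = hd (us @ f # vs)"
    by (cases us) auto
  let ?k = "int (length us)"
  consider "i < ?k" | "i = ?k" | "i = ?k + 1" | "i > ?k + 1"
    by linarith
  then show "list_path C (us @ f # ident C (src C f) # vs) i =
      insert_identity C (?k + 1) (src C f) (list_path C (us @ f # vs)) i"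
  proof cases
    case 4
    define j where "j = nat (i - ?k - 2)"
    have "i = ?k + 2 + int j"
      using 4 by (simp add: j_def)
    moreover have "nat (?k + 2 + int j) = length us + Suc (Suc j)"
        "nat (?k + 1 + int j) = length us + Suc j"
      by auto
    ultimately show ?thesis
      by (auto simp: list_path_def insert_identity_def nth_append f algebra_simps)
  qed (auto simp: list_path_def insert_identity_def nth_append hd nat_add_distrib)
qed

lemma contraction_list_path:
  assumes "(p, q) \<in> congenial C"
  shows "contraction C (list_path C (us @ p # q # vs))
           (list_path C (us @ p \<cdot> q # ident C (src C q) # vs))"
proof -
  let ?k = "int (length us)"
  let ?l = "list_path C (us @ p # q # vs)"
  have pq: "composable C p q"
    using assms congenial_suave by auto
  then have tgt: "tgt C (p \<cdot> q) = tgt C p"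
    using compose_Hom[of p q] by (auto simp: Hom_def)
  have id: "src C (ident C (src C q)) = src C q"
    using pq ident_Hom[OF src_Obj, of q] by (auto simp: Hom_def composable_def)
  have at: "?l ?k = p" "?l (?k + 1) = q"
    by (auto simp: list_path_def nth_append nat_add_distrib)
  have hd: "tgt C (hd (us @ p \<cdot> q # ident C (src C q) # vs)) = tgt C (hd (us @ p # q # vs))"
    using tgt by (cases us) auto
  have "list_path C (us @ p \<cdot> q # ident C (src C q) # vs) =
      ?l(?k := p \<cdot> q, ?k + 1 := ident C (src C q))"
  proof
    fix i :: int
    consider "i < ?k" | "i = ?k" | "i = ?k + 1" | "i > ?k + 1"
      by linarith
    then show "list_path C (us @ p \<cdot> q # ident C (src C q) # vs) i =
        (?l(?k := p \<cdot> q, ?k + 1 := ident C (src C q))) i"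
    proof cases
      case 4
      define j where "j = nat (i - ?k - 2)"
      have "i = ?k + 2 + int j"
        using 4 by (simp add: j_def)
      moreover have "nat (?k + 2 + int j) = length us + Suc (Suc j)"
        by auto
      ultimately show ?thesis
        by (auto simp: list_path_def nth_append id)
    qed (auto simp: list_path_def nth_append hd nat_add_distrib)
  qed
  then show ?thesis
    unfolding contraction_def using assms at by (intro exI[of _ ?k]) simp
qed

text \<open>
  Contracting a path keeps an identity in the freed position. The contracted path thus
  represents the word with \<open>p \<cdot> q\<close> followed by that identity, and this word differs from the
  shorter one by an insertion only.
\<close>

lemma WW_class_contract:
  assumes "suave_word C (us @ p # q # vs)" "(p, q) \<in> congenial C"
  shows "WW_class C (us @ p # q # vs) = WW_class C (us @ p \<cdot> q # vs)"
proof -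
  let ?l = "list_path C (us @ p # q # vs)"
    and ?m = "list_path C (us @ p \<cdot> q # ident C (src C q) # vs)"
    and ?r = "list_path C (us @ p \<cdot> q # vs)"
  have q: "q \<in> Mor C" and pq: "p \<cdot> q \<in> Mor C" "src C (p \<cdot> q) = src C q"
    using assms(2) congenial_suave compose_Hom[of p q]
    by (auto simp: Hom_def composable_def)
  have short: "suave_word C (us @ p \<cdot> q # vs)"
    using suave_word_contract[OF assms] .
  \<comment> \<open>Inserting the identity expands \<open>p \<cdot> q\<close> into a congenial pair.\<close>
  have "p \<cdot> q \<cdot> ident C (src C q) = p \<cdot> q"
    using compose_ident[OF pq(1)] pq(2) by simp
  moreover have "(p \<cdot> q, ident C (src C q)) \<in> congenial C"
    using ident_congenial[of "p \<cdot> q" "ident C (src C q)"] composable_ident_right[OF pq(1)] pq(2)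
      compose_suave[OF assms(2)] ident_suave[OF src_Obj[OF q]] src_Obj[OF q]
    by (auto simp: identities_def)
  ultimately have long: "suave_word C (us @ p \<cdot> q # ident C (src C q) # vs)"
    using suave_word_expand[of us "p \<cdot> q" "ident C (src C q)" vs] short by simp
  have paths: "?l \<in> paths C" "?m \<in> paths C" "?r \<in> paths C"
    using list_path_suave_paths assms(1) short long by (auto simp: suave_paths_def)
  have "?m = insert_identity C (int (length us) + 1) (src C q) ?r"
    using list_path_insert_identity[OF pq(1), of us vs] pq(2) by simp
  then have "(?r, ?m) \<in> path_equiv C"
    unfolding path_equiv_def using paths src_Obj[OF q] by (intro generated_equiv_base) auto
  moreover have "?l \<in> path_equiv C `` {?l}"
    using equiv_class_self[OF equiv_path_equiv paths(1)] .
  ultimately have "(path_equiv C `` {?l}, path_equiv C `` {?r}) \<in> WW_equiv C"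
    unfolding WW_equiv_def
    using path_class_Mor_Ps[OF assms(1)] path_class_Mor_Ps[OF short]
      contraction_list_path[OF assms(2), of us vs]
    by (intro generated_equiv_base) blast
  then show ?thesis
    unfolding WW_class_def by (rule equiv_class_eq[OF equiv_WW_equiv])
qed

end

section \<open>Absorbing a word into a reduction and a coreduction\<close>

context highly_selective_category
begin

text \<open>
  The word is absorbed from the left, with \<open>hs\<close> the part still to be absorbed. Since \<open>hs\<close>
  stays in the word throughout the induction, each step is a contraction or an expansion of the
  whole word, and the class of a word need not be assembled from the classes of its parts.
\<close>

lemma absorb_into_reduction_coreduction:
  assumes "suave_word C (A # B # hs)" "A \<in> reductions C" "B \<in> coreductions C"
  shows "\<exists>A'\<in>reductions C. \<exists>B'\<in>coreductions C. composable C A' B' \<and>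
    tgt C A' = tgt C A \<and> src C B' = src C (last (B # hs)) \<and>
    WW_class C (A # B # hs) = WW_class C [A', B']"
  using assms
proof (induction hs arbitrary: A B)
  case Nil
  then show ?case
    by (auto simp: suave_word_def)
next
  case (Cons f hs)
  have suave: "A \<in> suave C" "B \<in> suave C" "f \<in> suave C"
    and comp: "composable C A B" "composable C B f"
    using Cons.prems(1) by (auto simp: suave_word_def)
  have Bf: "(B, f) \<in> congenial C"
    using reduction_congenial[OF suave(2,3) comp(2)] Cons.prems(3) by simp
  obtain g h where gh: "g \<in> reductions C" "h \<in> coreductions C" "(g, h) \<in> congenial C"
      "B \<cdot> f = g \<cdot> h"
    using suave_factor[OF compose_suave[OF Bf]] by blast
  have comp_gh: "composable C g h"
    using congenial_suave[OF gh(3)] by simp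
  have ends: "tgt C g = tgt C B" "src C h = src C f"
    using compose_Hom[OF comp(2)] compose_Hom[OF comp_gh] gh(4) by (auto simp: Hom_def)
  have comp_Ag: "composable C A g"
    using comp(1) comp_gh ends(1) by (auto simp: composable_def)
  then have Ag: "(A, g) \<in> congenial C"
    using reduction_congenial[of A g] suave(1) gh(1) reductions_suave by auto
  have red: "A \<cdot> g \<in> reductions C"
    using reductions_subcategory Cons.prems(2) gh(1) comp_Ag by (auto simp: subcategory_def)
  have w1: "suave_word C (A # g \<cdot> h # hs)"
    using suave_word_contract[of "[A]" B f hs] Cons.prems(1) Bf gh(4) by simp
  have w2: "suave_word C (A # g # h # hs)"
    using suave_word_expand[of "[A]" g h hs] w1 gh(3) by simp
  have w3: "suave_word C (A \<cdot> g # h # hs)"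
    using suave_word_contract[of "[]" A g "h # hs"] w2 Ag by simp
  have "WW_class C (A # B # f # hs) = WW_class C (A # g \<cdot> h # hs)"
    using WW_class_contract[of "[A]" B f hs] Cons.prems(1) Bf gh(4) by simp
  also have "\<dots> = WW_class C (A # g # h # hs)"
    using WW_class_contract[of "[A]" g h hs] w2 gh(3) by simp
  also have "\<dots> = WW_class C (A \<cdot> g # h # hs)"
    using WW_class_contract[of "[]" A g "h # hs"] w2 Ag by simp
  finally have "WW_class C (A # B # f # hs) = WW_class C (A \<cdot> g # h # hs)" .
  moreover have "tgt C (A \<cdot> g) = tgt C A"
    using compose_Hom[OF comp_Ag] by (simp add: Hom_def)
  moreover have "src C (last (h # hs)) = src C (last (B # f # hs))"
    using ends(2) by simp
  ultimately show ?case
    using Cons.IH[OF w3 red gh(2)] by simp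
qed

lemma suave_word_eq_reduction_coreduction:
  assumes "suave_word C fs"
  shows "\<exists>A\<in>reductions C. \<exists>B\<in>coreductions C. composable C A B \<and>
    tgt C A = tgt C (hd fs) \<and> src C B = src C (last fs) \<and> WW_class C fs = WW_class C [A, B]"
proof -
  obtain f hs where fs: "fs = f # hs"
    using assms by (cases fs) (auto simp: suave_word_def)
  have "f \<in> suave C"
    using assms fs by (simp add: suave_word_def)
  then obtain g h where gh: "g \<in> reductions C" "h \<in> coreductions C" "(g, h) \<in> congenial C"
      "f = g \<cdot> h"
    using suave_factor by blast
  have ends: "tgt C g = tgt C f" "src C h = src C f"
    using congenial_suave[OF gh(3)] compose_Hom[of g h] gh(4) by (auto simp: Hom_def)
  have w: "suave_word C (g # h # hs)"
    using suave_word_expand[of "[]" g h hs] assms fs gh by simp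
  have "WW_class C fs = WW_class C (g # h # hs)"
    using WW_class_contract[of "[]" g h hs] w gh fs by simp
  moreover have "src C (last (h # hs)) = src C (last fs)"
    using ends(2) fs by simp
  ultimately show ?thesis
    using absorb_into_reduction_coreduction[OF w gh(1,2)] ends(1) fs by simp
qed

end

theorem theorem3p3:
  fixes C :: "('o, 'm, 'z) highly_selective_category_scheme"
    and n :: nat and X :: "nat \<Rightarrow> 'o" and f :: "nat \<Rightarrow> 'm"
  assumes "highly_selective_category C"
    and "n \<ge> 1"
    and "\<forall>j\<in>{1..n}. f j \<in> Hom C (X (j - 1)) (X j) \<and> f j \<in> suave C"
  shows "\<exists>Q\<in>Obj C. \<exists>A\<in>Hom C (X 0) Q. \<exists>B\<in>Hom C Q (X n).
    A \<in> reductions C \<and> B \<in> coreductions C \<and>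
    WW_class C (map f [1..<Suc n]) = WW_class C [A, B]"
proof -
  interpret highly_selective_category C by fact
  let ?fs = "map f [1..<Suc n]"
  have ne: "?fs \<noteq> []"
    using assms(2) by simp
  have "composable C (?fs ! i) (?fs ! Suc i)" if "Suc i < length ?fs" for i
  proof -
    have "?fs ! i = f (Suc i)" "?fs ! Suc i = f (Suc (Suc i))"
      using that by (simp_all del: upt_Suc)
    moreover have "Suc i \<in> {1..n}" "Suc (Suc i) \<in> {1..n}"
      using that by (auto simp del: upt_Suc)
    ultimately show ?thesis
      using assms(3)[rule_format, of "Suc i"] assms(3)[rule_format, of "Suc (Suc i)"]
      by (simp add: composable_def Hom_def del: upt_Suc)
  qed
  then have "suave_word C ?fs"
    using assms(3) ne by (auto simp: suave_word_def successively_conv_nth simp del: upt_Suc)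
  then obtain A B where AB: "A \<in> reductions C" "B \<in> coreductions C" "composable C A B"
      "tgt C A = tgt C (hd ?fs)" "src C B = src C (last ?fs)" "WW_class C ?fs = WW_class C [A, B]"
    using suave_word_eq_reduction_coreduction by blast
  have "hd ?fs = f 1"
    using assms(2) by (simp add: hd_conv_nth del: upt_Suc)
  moreover have "last ?fs = f n"
    using assms(2) by simp
  moreover have "f 1 \<in> Hom C (X 0) (X 1)" "f n \<in> Hom C (X (n - 1)) (X n)"
    using assms(2) assms(3)[rule_format, of 1] assms(3)[rule_format, of n] by simp_all
  ultimately have "tgt C A = X 0" "src C B = X n"
    using AB(4,5) by (simp_all add: Hom_def del: upt_Suc)
  then have "A \<in> Hom C (X 0) (src C A)" "B \<in> Hom C (src C A) (X n)" "src C A \<in> Obj C"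
    using AB(3) src_Obj[of A] by (auto simp: composable_def Hom_def)
  then show ?thesis
    using AB(1,2,6) by blast
qed

end
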